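(* Let $q_1,\dots,q_{m+1}$ be probability densities in $L^2(\mathbb{R}^n)$, and consider the simple mixture family $$\Big\{\,p(\theta)=\theta_1q_1+\dots+\theta_mq_m+\big[1-(\theta_1+\dots+\theta_m)\big]q_{m+1}\;:\;\sum_{i=1}^m\theta_i<1,\ \theta_i\ge 0 \text{ for all } i\Big\}.$$ For this family, the direct $L^2$ projection filter $$d\theta_i=\sum_{j=1}^m h^{ij}\Big\{\langle p(\theta),\mathcal{L}_tv_j\rangle\,dt-\langle\gamma^0_t(p(\theta)),v_j\rangle\,dt+\sum_{k=1}^d\langle\gamma_t^k(p(\theta)),v_j\rangle\circ dY^k_t\Big\},\qquad i=1,\dots,m,$$ coincides with a Galerkin method $$\sum_{i=1}^{\ell}\langle\phi_i,\phi_j\rangle\,dc_i=\sum_{i=1}^{\ell}\langle\phi_i,\mathcal{L}_t\phi_j\rangle c_i\,dt-\Big\langle\gamma^0_t\Big(\sum_{r=1}^{\ell}c_r\phi_r\Big),\phi_j\Big\rangle dt+\sum_{k=1}^d\Big\langle\gamma^k_t\Big(\sum_{r=1}^{\ell}c_r\phi_r\Big),\phi_j\Big\rangle\circ dY_t^k,\qquad j=1,\dots,\ell,$$ where the basis functions are the mixture components $q$; the identification being $\ell=m+1$, $c_i=\theta_i$ and $\phi_i=q_i-q_{m+1}$ for $i=1,\dots,m$, and $c_{m+1}=1$, $\phi_{m+1}=q_{m+1}$.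
   Context: Filtering problem: the signal $X_t\in\mathbb{R}^n$ and observation $Y_t\in\mathbb{R}^d$ satisfy $dX_t=f_t(X_t)\,dt+\sigma_t(X_t)\,dW_t$, $dY_t=b_t(X_t)\,dt+dV_t$, $Y_0=0$, where $X_0$ and the Brownian motions $W$, $V$ are independent and $V$ has identity covariance. Put $a_t=\sigma_t\sigma_t^T$ and $$\mathcal{L}_t=\sum_{i=1}^n f^i_t\frac{\partial}{\partial x_i}+\frac12\sum_{i,j=1}^n a_t^{ij}\frac{\partial^2}{\partial x_i\partial x_j},$$ with formal adjoint $\mathcal{L}_t^*$. For a function $p$ on $\mathbb{R}^n$ let $E_p\{g\}=\int g\,p\,dx$, and $$\gamma^0_t(p)=\tfrac12\big[|b_t|^2-E_p\{|b_t|^2\}\big]p,\qquad \gamma^k_t(p)=\big[b^k_t-E_p\{b^k_t\}\big]p,\quad k=1,\dots,d.$$ The Kushner--Stratonovich equation for the conditional density $p_t$ of $X_t$ given the observations up to time $t$ is, in Stratonovich form ($\circ$ denotes Stratonovich differentials), $dp_t=\mathcal{L}_t^*p_t\,dt-\gamma_t^0(p_t)\,dt+\sum_{k=1}^d\gamma_t^k(p_t)\circ dY^k_t$. $\langle\cdot,\cdot\rangle$ is the $L^2(\mathbb{R}^n)$ inner product with respect to Lebesgue measure. For a smoothly parameterized family $\theta\mapsto p(\theta)$ of square integrable densities, put $v_i=\partial p/\partial\theta_i$ (required to be linearly independent, as part of the definition of a smooth family), $h_{ij}=\langle v_i,v_j\rangle$, and let $(h^{ij})$ be the inverse matrix of $(h_{ij})$.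 The direct $L^2$ projection filter, i.e. the first equation in the claim, is obtained by projecting the Kushner--Stratonovich equation orthogonally in $L^2$ onto $\mathrm{span}\{v_1,\dots,v_m\}$. For the simple mixture family, $v_j=q_j-q_{m+1}$ and $h_{ij}=\langle q_i-q_{m+1},q_j-q_{m+1}\rangle$. The Galerkin method approximates the solution of the Kushner--Stratonovich equation by $\tilde p_t=\sum_{i=1}^\ell c_i(t)\phi_i$ and requires $$\Big\langle -d\tilde p_t+\mathcal{L}_t^*\tilde p_t\,dt-\gamma^0_t(\tilde p_t)\,dt+\sum_{k=1}^d\gamma_t^k(\tilde p_t)\circ dY_t^k,\ \phi_j\Big\rangle=0,\qquad j=1,\dots,\ell;$$ substituting $\tilde p_t$ and integrating by parts gives the second equation in the claim.
   Formalization: The Galerkin equations are imposed only for j=1,…,m: since c_{m+1}=1 is prescribed, the equation j=m+1 is dropped, because with it the system is overdetermined and the coincidence fails (e.g. f=b=0, σ=√2, two Gaussians centred at ±μ, θ=1/2). *)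

theory Defs
  imports "HOL-Probability.Probability"
begin

section \<open>The filtering problem\<close>

text \<open>
  Time is a real parameter; processes are functions of time and outcome of which only the
  values at times \<open>t \<ge> 0\<close> are constrained.
\<close>

definition adapted :: "(real \<Rightarrow> 'w measure) \<Rightarrow> (real \<Rightarrow> 'w \<Rightarrow> 'b::topological_space) \<Rightarrow> bool" where
  "adapted F Z \<longleftrightarrow> (\<forall>t\<ge>0. Z t \<in> borel_measurable (F t))"

definition conv_in_prob :: "'w measure \<Rightarrow> (nat \<Rightarrow> 'w \<Rightarrow> real) \<Rightarrow> ('w \<Rightarrow> real) \<Rightarrow> bool" where
  "conv_in_prob M S J \<longleftrightarrow>
     (\<forall>n. S n \<in> borel_measurable M) \<and> J \<in> borel_measurable M \<and>
     (\<forall>\<epsilon>>0. (\<lambda>n. measure M {\<omega>\<in>space M. \<bar>S n \<omega> - J \<omega>\<bar> > \<epsilon>}) \<longlonglongrightarrow> 0)"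

definition brownian_motion ::
  "'w measure \<Rightarrow> (real \<Rightarrow> 'w measure) \<Rightarrow> (real \<Rightarrow> 'w \<Rightarrow> real^'r) \<Rightarrow> bool" where
  "brownian_motion M F B \<longleftrightarrow>
     adapted F B \<and>
     (\<forall>\<omega>\<in>space M. B 0 \<omega> = 0 \<and> continuous_on {0..} (\<lambda>t. B t \<omega>)) \<and>
     (\<forall>s t. 0 \<le> s \<and> s < t \<longrightarrow>
        (\<forall>k. distributed M lborel (\<lambda>\<omega>. B t \<omega> $ k - B s \<omega> $ k) (normal_density 0 (sqrt (t - s)))) \<and>
        prob_space.indep_vars M (\<lambda>_. borel) (\<lambda>k \<omega>. B t \<omega> $ k - B s \<omega> $ k) UNIV \<and>
        prob_space.indep_set M (sets (F s))
          {(\<lambda>\<omega>. B t \<omega> - B s \<omega>) -` A \<inter> space M | A. A \<in> sets borel})"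

definition generated_events :: "'w measure \<Rightarrow> real set \<Rightarrow> (real \<Rightarrow> 'w \<Rightarrow> 'b::topological_space) \<Rightarrow> 'w set set" where
  "generated_events M T Z = sigma_sets (space M) {Z t -` A \<inter> space M | t A. t \<in> T \<and> A \<in> sets borel}"

definition simple_integrand ::
  "'w measure \<Rightarrow> (real \<Rightarrow> 'w measure) \<Rightarrow> nat \<Rightarrow> (nat \<Rightarrow> real) \<Rightarrow> (nat \<Rightarrow> 'w \<Rightarrow> real) \<Rightarrow> bool" where
  "simple_integrand M F N s \<xi> \<longleftrightarrow>
     0 \<le> s 0 \<and> (\<forall>i<N. s i \<le> s (Suc i)) \<and>
     (\<forall>i<N. \<xi> i \<in> borel_measurable (F (s i)) \<and> (\<exists>C. \<forall>\<omega>\<in>space M. \<bar>\<xi> i \<omega>\<bar> \<le> C))"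

text \<open>
  \<open>J\<close> is (a version of) the Ito integral of \<open>H\<close> against the scalar Brownian motion \<open>B\<close> over
  \<open>[0, t]\<close>: simple integrands \<open>\<Sum>\<^sub>i \<xi>\<^sub>i 1\<^bsub>(s\<^sub>i, s\<^sub>i\<^sub>+\<^sub>1]\<^esub>\<close> approximate \<open>H\<close> in \<open>L\<^sup>2[0, t]\<close> in probability
  and their elementary integrals converge to \<open>J\<close> in probability.
\<close>

definition has_ito_integral ::
  "'w measure \<Rightarrow> (real \<Rightarrow> 'w measure) \<Rightarrow> (real \<Rightarrow> 'w \<Rightarrow> real) \<Rightarrow> (real \<Rightarrow> 'w \<Rightarrow> real) \<Rightarrow> real
     \<Rightarrow> ('w \<Rightarrow> real) \<Rightarrow> bool" where
  "has_ito_integral M F H B t J \<longleftrightarrow>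
     (\<lambda>(u, \<omega>). indicator {0..t} u * H u \<omega>) \<in> borel_measurable (lborel \<Otimes>\<^sub>M M) \<and>
     (\<exists>N s \<xi>. (\<forall>n. simple_integrand M F (N n) (s n) (\<xi> n)) \<and>
        (\<forall>\<epsilon>>0. (\<lambda>n. measure M {\<omega>\<in>space M.
            (\<integral>\<^sup>+u\<in>{0..t}. ennreal ((H u \<omega> -
               (\<Sum>i<N n. \<xi> n i \<omega> * indicator {s n i<..s n (Suc i)} u))\<^sup>2) \<partial>lborel) > ennreal \<epsilon>})
          \<longlonglongrightarrow> 0) \<and>
        conv_in_prob M
          (\<lambda>n \<omega>. \<Sum>i<N n. \<xi> n i \<omega> * (B (min t (s n (Suc i))) \<omega> - B (min t (s n i)) \<omega>)) J)"

text \<open>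
  \<open>dX = f(X) dt + \<sigma>(X) dW\<close>, \<open>dY = b(X) dt + dV\<close>, \<open>Y\<^sub>0 = 0\<close>, with \<open>X\<^sub>0\<close>, \<open>W\<close>, \<open>V\<close> independent.
\<close>

definition filtering_problem ::
  "'w measure \<Rightarrow> (real \<Rightarrow> 'w measure) \<Rightarrow>
   (real \<Rightarrow> real^'n \<Rightarrow> real^'n) \<Rightarrow> (real \<Rightarrow> real^'n \<Rightarrow> real^'r^'n) \<Rightarrow> (real \<Rightarrow> real^'n \<Rightarrow> real^'d) \<Rightarrow>
   (real \<Rightarrow> 'w \<Rightarrow> real^'n) \<Rightarrow> (real \<Rightarrow> 'w \<Rightarrow> real^'d) \<Rightarrow>
   (real \<Rightarrow> 'w \<Rightarrow> real^'r) \<Rightarrow> (real \<Rightarrow> 'w \<Rightarrow> real^'d) \<Rightarrow> bool" where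
  "filtering_problem M F f \<sigma> b X Y W V \<longleftrightarrow>
     prob_space M \<and> filtration (space M) F \<and> (\<forall>t. sets (F t) \<subseteq> sets M) \<and>
     (\<lambda>(t, x). f t x) \<in> borel_measurable borel \<and>
     (\<lambda>(t, x). \<sigma> t x) \<in> borel_measurable borel \<and>
     (\<lambda>(t, x). b t x) \<in> borel_measurable borel \<and>
     brownian_motion M F W \<and> brownian_motion M F V \<and>
     prob_space.indep_sets M
       (\<lambda>i. [generated_events M {0} X, generated_events M {0..} W, generated_events M {0..} V] ! i)
       {..<3} \<and>
     adapted F X \<and> (\<forall>\<omega>\<in>space M. continuous_on {0..} (\<lambda>t. X t \<omega>)) \<and>
     adapted F Y \<and> (\<forall>\<omega>\<in>space M. Y 0 \<omega> = 0 \<and> continuous_on {0..} (\<lambda>t. Y t \<omega>)) \<and>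
     (\<forall>t\<ge>0. AE \<omega> in M. set_integrable lborel {0..t} (\<lambda>s. f s (X s \<omega>))) \<and>
     (\<forall>i. \<exists>J. (\<forall>k. \<forall>t\<ge>0. has_ito_integral M F (\<lambda>s \<omega>. \<sigma> s (X s \<omega>) $ i $ k) (\<lambda>s \<omega>. W s \<omega> $ k) t (J k t)) \<and>
        (\<forall>t\<ge>0. AE \<omega> in M.
           X t \<omega> $ i = X 0 \<omega> $ i + (LINT s:{0..t}|lborel. f s (X s \<omega>) $ i) + (\<Sum>k\<in>UNIV. J k t \<omega>))) \<and>
     (\<forall>t\<ge>0. AE \<omega> in M. set_integrable lborel {0..t} (\<lambda>s. b s (X s \<omega>)) \<and>
        Y t \<omega> = (LINT s:{0..t}|lborel. b s (X s \<omega>)) + V t \<omega>)"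

section \<open>Stratonovich equations\<close>

text \<open>
  The Stratonovich integral over \<open>[0, t]\<close> as the limit in probability of the trapezoidal sums
  along all sequences of partitions of \<open>[0, t]\<close> with mesh tending to zero.
\<close>

definition vanishing_partitions :: "real \<Rightarrow> (nat \<Rightarrow> nat) \<Rightarrow> (nat \<Rightarrow> nat \<Rightarrow> real) \<Rightarrow> bool" where
  "vanishing_partitions t N s \<longleftrightarrow>
     (\<forall>n. s n 0 = 0 \<and> s n (N n) = t \<and> (\<forall>i<N n. s n i \<le> s n (Suc i))) \<and>
     (\<forall>\<delta>>0. \<forall>\<^sub>F n in sequentially. \<forall>i<N n. s n (Suc i) - s n i < \<delta>)"

definition has_stratonovich_integral ::
  "'w measure \<Rightarrow> (real \<Rightarrow> 'w \<Rightarrow> real) \<Rightarrow> (real \<Rightarrow> 'w \<Rightarrow> real) \<Rightarrow> real \<Rightarrow> ('w \<Rightarrow> real) \<Rightarrow> bool" where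
  "has_stratonovich_integral M H Z t J \<longleftrightarrow>
     (\<forall>N s. vanishing_partitions t N s \<longrightarrow>
        conv_in_prob M
          (\<lambda>n \<omega>. \<Sum>i<N n. (H (s n i) \<omega> + H (s n (Suc i)) \<omega>) / 2 * (Z (s n (Suc i)) \<omega> - Z (s n i) \<omega>)) J)"

definition stopped :: "('w \<Rightarrow> real) \<Rightarrow> (real \<Rightarrow> 'w \<Rightarrow> 'b) \<Rightarrow> real \<Rightarrow> 'w \<Rightarrow> 'b" where
  "stopped \<tau> Z t \<omega> = Z (min t (\<tau> \<omega>)) \<omega>"

text \<open>
  The scalar equation \<open>dZ = A dt + \<Sum>\<^sub>k B\<^sub>k \<circ> dY\<^sup>k\<close> on the stochastic interval \<open>[0, \<tau>]\<close>. Stopping is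
  needed because a solution may leave the parameter domain of a family, so that in general
  filters only have local solutions.
\<close>

definition stratonovich_eq ::
  "'w measure \<Rightarrow> (real \<Rightarrow> 'w \<Rightarrow> real^'d) \<Rightarrow> ('w \<Rightarrow> real) \<Rightarrow> (real \<Rightarrow> 'w \<Rightarrow> real) \<Rightarrow>
   (real \<Rightarrow> 'w \<Rightarrow> real) \<Rightarrow> ('d \<Rightarrow> real \<Rightarrow> 'w \<Rightarrow> real) \<Rightarrow> bool" where
  "stratonovich_eq M Y \<tau> Z A B \<longleftrightarrow>
     (\<forall>t\<ge>0. AE \<omega> in M. set_integrable lborel {0..min t (\<tau> \<omega>)} (\<lambda>s. A s \<omega>)) \<and>
     (\<exists>J. (\<forall>k. \<forall>t\<ge>0. has_stratonovich_integral M (stopped \<tau> (B k)) (stopped \<tau> (\<lambda>s \<omega>. Y s \<omega> $ k)) t (J k t)) \<and>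
        (\<forall>t\<ge>0. AE \<omega> in M.
           stopped \<tau> Z t \<omega> - Z 0 \<omega> =
             (LINT s:{0..min t (\<tau> \<omega>)}|lborel. A s \<omega>) + (\<Sum>k\<in>UNIV. J k t \<omega>)))"

section \<open>The coefficients of the Kushner--Stratonovich equation\<close>

definition l2_inner :: "(real^'n \<Rightarrow> real) \<Rightarrow> (real^'n \<Rightarrow> real) \<Rightarrow> real" where
  "l2_inner u v = (\<integral>x. u x * v x \<partial>lborel)"

definition pdiff :: "'i::finite \<Rightarrow> (real^'i \<Rightarrow> real) \<Rightarrow> real^'i \<Rightarrow> real" where
  "pdiff i u x = deriv (\<lambda>s. u (x + s *\<^sub>R axis i 1)) 0"

text \<open>Exactly the derivatives that enter \<open>backward_op\<close> are required to exist.\<close>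

definition twice_pdifferentiable :: "(real^'n \<Rightarrow> real) \<Rightarrow> bool" where
  "twice_pdifferentiable u \<longleftrightarrow>
     (\<forall>x i. (\<lambda>s. u (x + s *\<^sub>R axis i 1)) differentiable (at (0::real)) \<and>
        (\<forall>j. (\<lambda>s. pdiff j u (x + s *\<^sub>R axis i 1)) differentiable (at (0::real))))"

text \<open>The operator \<open>\<L>\<^sub>t\<close>, at a fixed time, with \<open>a = \<sigma> \<sigma>\<^sup>T\<close>.\<close>

definition backward_op ::
  "(real^'n \<Rightarrow> real^'n) \<Rightarrow> (real^'n \<Rightarrow> real^'r^'n) \<Rightarrow> (real^'n \<Rightarrow> real) \<Rightarrow> real^'n \<Rightarrow> real" where
  "backward_op f \<sigma> u x =
     (\<Sum>i\<in>UNIV. f x $ i * pdiff i u x) +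
     1/2 * (\<Sum>i\<in>UNIV. \<Sum>j\<in>UNIV. (\<sigma> x ** transpose (\<sigma> x)) $ i $ j * pdiff i (pdiff j u) x)"

definition expect :: "(real^'n \<Rightarrow> real) \<Rightarrow> (real^'n \<Rightarrow> real) \<Rightarrow> real" where
  "expect p g = (\<integral>x. g x * p x \<partial>lborel)"

definition gamma0 :: "(real^'n \<Rightarrow> real^'d) \<Rightarrow> (real^'n \<Rightarrow> real) \<Rightarrow> real^'n \<Rightarrow> real" where
  "gamma0 b p x = 1/2 * ((norm (b x))\<^sup>2 - expect p (\<lambda>y. (norm (b y))\<^sup>2)) * p x"

definition gamma :: "(real^'n \<Rightarrow> real^'d) \<Rightarrow> 'd \<Rightarrow> (real^'n \<Rightarrow> real) \<Rightarrow> real^'n \<Rightarrow> real" where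
  "gamma b k p x = (b x $ k - expect p (\<lambda>y. b y $ k)) * p x"

section \<open>The direct \<open>L\<^sup>2\<close> projection filter\<close>

definition l2_density :: "(real^'n \<Rightarrow> real) \<Rightarrow> bool" where
  "l2_density u \<longleftrightarrow>
     u \<in> borel_measurable lborel \<and> (\<forall>x. 0 \<le> u x) \<and>
     integrable lborel u \<and> (\<integral>x. u x \<partial>lborel) = 1 \<and> integrable lborel (\<lambda>x. (u x)\<^sup>2)"

definition tangent :: "(real^'m \<Rightarrow> real^'n \<Rightarrow> real) \<Rightarrow> real^'m \<Rightarrow> 'm \<Rightarrow> real^'n \<Rightarrow> real" where
  "tangent p \<theta> i x = pdiff i (\<lambda>\<eta>. p \<eta> x) \<theta>"

text \<open>Linear independence in \<open>L\<^sup>2\<close>, i.e. of the classes modulo null functions.\<close>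

definition l2_independent :: "('m::finite \<Rightarrow> real^'n \<Rightarrow> real) \<Rightarrow> bool" where
  "l2_independent v \<longleftrightarrow>
     (\<forall>c. (AE x in lborel. (\<Sum>i\<in>UNIV. c i * v i x) = 0) \<longrightarrow> (\<forall>i. c i = 0))"

definition gram :: "(real^'m \<Rightarrow> real^'n \<Rightarrow> real) \<Rightarrow> real^'m \<Rightarrow> real^'m^'m" where
  "gram p \<theta> = (\<chi> i j. l2_inner (tangent p \<theta> i) (tangent p \<theta> j))"

definition projection_filter ::
  "'w measure \<Rightarrow> (real \<Rightarrow> real^'n \<Rightarrow> real^'n) \<Rightarrow> (real \<Rightarrow> real^'n \<Rightarrow> real^'r^'n) \<Rightarrow>
   (real \<Rightarrow> real^'n \<Rightarrow> real^'d) \<Rightarrow> (real \<Rightarrow> 'w \<Rightarrow> real^'d) \<Rightarrow> ('w \<Rightarrow> real) \<Rightarrow>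
   (real^'m \<Rightarrow> real^'n \<Rightarrow> real) \<Rightarrow> (real \<Rightarrow> 'w \<Rightarrow> real^'m) \<Rightarrow> bool" where
  "projection_filter M f \<sigma> b Y \<tau> p \<theta> \<longleftrightarrow>
     (\<forall>i. stratonovich_eq M Y \<tau> (\<lambda>t \<omega>. \<theta> t \<omega> $ i)
        (\<lambda>t \<omega>. \<Sum>j\<in>UNIV. matrix_inv (gram p (\<theta> t \<omega>)) $ i $ j *
           (l2_inner (p (\<theta> t \<omega>)) (backward_op (f t) (\<sigma> t) (tangent p (\<theta> t \<omega>) j)) -
            l2_inner (gamma0 (b t) (p (\<theta> t \<omega>))) (tangent p (\<theta> t \<omega>) j)))
        (\<lambda>k t \<omega>. \<Sum>j\<in>UNIV. matrix_inv (gram p (\<theta> t \<omega>)) $ i $ j *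
           l2_inner (gamma (b t) k (p (\<theta> t \<omega>))) (tangent p (\<theta> t \<omega>) j)))"

section \<open>The Galerkin method\<close>

definition galerkin_sum :: "('l::finite \<Rightarrow> real^'n \<Rightarrow> real) \<Rightarrow> real^'l \<Rightarrow> real^'n \<Rightarrow> real" where
  "galerkin_sum \<phi> c x = (\<Sum>r\<in>UNIV. c $ r * \<phi> r x)"

text \<open>
  \<open>U\<close> is the set of indices of the unknown coefficients: the residual of the equation is tested
  against \<open>\<phi>\<^sub>j\<close> for \<open>j \<in> U\<close>, while a coefficient \<open>c\<^sub>j\<close> with \<open>j \<notin> U\<close> is prescribed and gives
  rise to no equation. The method with all coefficients unknown is \<open>U = UNIV\<close>.
\<close>

definition galerkin_method ::
  "'w measure \<Rightarrow> (real \<Rightarrow> real^'n \<Rightarrow> real^'n) \<Rightarrow> (real \<Rightarrow> real^'n \<Rightarrow> real^'r^'n) \<Rightarrow>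
   (real \<Rightarrow> real^'n \<Rightarrow> real^'d) \<Rightarrow> (real \<Rightarrow> 'w \<Rightarrow> real^'d) \<Rightarrow> ('w \<Rightarrow> real) \<Rightarrow>
   ('l::finite \<Rightarrow> real^'n \<Rightarrow> real) \<Rightarrow> 'l set \<Rightarrow> (real \<Rightarrow> 'w \<Rightarrow> real^'l) \<Rightarrow> bool" where
  "galerkin_method M f \<sigma> b Y \<tau> \<phi> U c \<longleftrightarrow>
     (\<forall>j\<in>U. stratonovich_eq M Y \<tau> (\<lambda>t \<omega>. \<Sum>i\<in>UNIV. l2_inner (\<phi> i) (\<phi> j) * c t \<omega> $ i)
        (\<lambda>t \<omega>. (\<Sum>i\<in>UNIV. l2_inner (\<phi> i) (backward_op (f t) (\<sigma> t) (\<phi> j)) * c t \<omega> $ i) -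
           l2_inner (gamma0 (b t) (galerkin_sum \<phi> (c t \<omega>))) (\<phi> j))
        (\<lambda>k t \<omega>. l2_inner (gamma (b t) k (galerkin_sum \<phi> (c t \<omega>))) (\<phi> j)))"

section \<open>Simple mixtures\<close>

text \<open>
  The index set \<open>{1, \<dots>, m + 1}\<close> is \<open>'m option\<close>: \<open>Some i\<close> stands for \<open>i \<le> m\<close>
  and \<open>None\<close> for \<open>m + 1\<close>.
\<close>

definition mixture_domain :: "(real^'m) set" where
  "mixture_domain = {\<theta>. (\<forall>i. 0 \<le> \<theta> $ i) \<and> (\<Sum>i\<in>UNIV. \<theta> $ i) < 1}"

definition mixture :: "('m::finite option \<Rightarrow> real^'n \<Rightarrow> real) \<Rightarrow> real^'m \<Rightarrow> real^'n \<Rightarrow> real" where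
  "mixture q \<theta> x = (\<Sum>i\<in>UNIV. \<theta> $ i * q (Some i) x) + (1 - (\<Sum>i\<in>UNIV. \<theta> $ i)) * q None x"

fun mixture_basis :: "('m option \<Rightarrow> real^'n \<Rightarrow> real) \<Rightarrow> 'm option \<Rightarrow> real^'n \<Rightarrow> real" where
  "mixture_basis q (Some i) x = q (Some i) x - q None x"
| "mixture_basis q None x = q None x"

definition mixture_coeff :: "real^'m \<Rightarrow> real^('m::finite option)" where
  "mixture_coeff \<theta> = (\<chi> r. case r of Some i \<Rightarrow> \<theta> $ i | None \<Rightarrow> 1)"

end

theory Submission
  imports Defs
begin

text \<open>
  In a simple mixture family the tangent vectors \<open>v\<^sub>j = q\<^sub>j - q\<^sub>m\<^sub>+\<^sub>1\<close> do not depend on the parameter,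
  so the Gram matrix \<open>h\<close> is one constant matrix, and \<open>p(\<theta>) = \<Sum>\<^sub>i \<theta>\<^sub>i v\<^sub>i + q\<^sub>m\<^sub>+\<^sub>1\<close> is exactly the
  Galerkin ansatz with the last coefficient prescribed to be 1. Write \<open>A\<^sub>j\<close> and \<open>B\<^sup>k\<^sub>j\<close> for the drift and
  the noise coefficients obtained by testing the equation against \<open>v\<^sub>j\<close>. The Galerkin equations then read
  \<open>\<Sum>\<^sub>i h\<^sub>j\<^sub>i d\<theta>\<^sub>i = A\<^sub>j dt + \<Sum>\<^sub>k B\<^sup>k\<^sub>j \<circ> dY\<^sup>k\<close>: the prescribed coefficient only adds the constant
  \<open>\<langle>q\<^sub>m\<^sub>+\<^sub>1, v\<^sub>j\<rangle>\<close> under the differential, which vanishes. The projection filter is the same system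
  multiplied by \<open>h\<^sup>-\<^sup>1\<close>.

  Two things make this rigorous. A Stratonovich system may be multiplied by a constant invertible
  matrix (\<open>stratonovich_eq_linear_system\<close>), because limits in probability of trapezoidal sums are
  linear in the integrand; and \<open>h\<close> is invertible because a vector in its kernel would be
  a linear relation between the \<open>v\<^sub>j\<close> in \<open>L\<^sup>2\<close> (\<open>invertible_gram\<close>). The drifts agree because
  \<open>\<L>\<^sub>t\<close> and the inner product are linear where the integrals exist
  (\<open>l2_inner_mixture_backward_op\<close>).
\<close>

section \<open>Linearity of Stratonovich equations\<close>

lemma conv_in_prob_scale:
  assumes "conv_in_prob M S J"
  shows "conv_in_prob M (\<lambda>n \<omega>. c * S n \<omega>) (\<lambda>\<omega>. c * J \<omega>)"
  unfolding conv_in_prob_def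
proof (intro conjI allI impI)
  have [measurable]: "\<And>n. S n \<in> borel_measurable M" "J \<in> borel_measurable M"
    using assms unfolding conv_in_prob_def by auto
  show "(\<lambda>\<omega>. c * S n \<omega>) \<in> borel_measurable M" for n by measurable
  show "(\<lambda>\<omega>. c * J \<omega>) \<in> borel_measurable M" by measurable
  fix \<epsilon> :: real assume "\<epsilon> > 0"
  show "(\<lambda>n. measure M {\<omega>\<in>space M. \<bar>c * S n \<omega> - c * J \<omega>\<bar> > \<epsilon>}) \<longlonglongrightarrow> 0"
  proof (cases "c = 0")
    case True
    then show ?thesis using \<open>\<epsilon> > 0\<close> by simp
  next
    case False
    have "(\<bar>c * S n \<omega> - c * J \<omega>\<bar> > \<epsilon>) = (\<bar>S n \<omega> - J \<omega>\<bar> > \<epsilon> / \<bar>c\<bar>)" for n \<omega>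
      using False by (simp add: abs_mult pos_divide_less_eq mult.commute flip: right_diff_distrib)
    moreover have "\<epsilon> / \<bar>c\<bar> > 0" using False \<open>\<epsilon> > 0\<close> by simp
    ultimately show ?thesis using assms unfolding conv_in_prob_def by simp
  qed
qed

lemma conv_in_prob_add:
  assumes M: "finite_measure M" and S: "conv_in_prob M S J" and T: "conv_in_prob M T K"
  shows "conv_in_prob M (\<lambda>n \<omega>. S n \<omega> + T n \<omega>) (\<lambda>\<omega>. J \<omega> + K \<omega>)"
  unfolding conv_in_prob_def
proof (intro conjI allI impI)
  interpret finite_measure M by fact
  have [measurable]: "\<And>n. S n \<in> borel_measurable M" "J \<in> borel_measurable M"
      "\<And>n. T n \<in> borel_measurable M" "K \<in> borel_measurable M"
    using S T unfolding conv_in_prob_def by auto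
  show "(\<lambda>\<omega>. S n \<omega> + T n \<omega>) \<in> borel_measurable M" for n by measurable
  show "(\<lambda>\<omega>. J \<omega> + K \<omega>) \<in> borel_measurable M" by measurable
  fix \<epsilon> :: real assume "\<epsilon> > 0"
  let ?s = "\<lambda>n. {\<omega>\<in>space M. \<bar>S n \<omega> - J \<omega>\<bar> > \<epsilon> / 2}"
  let ?t = "\<lambda>n. {\<omega>\<in>space M. \<bar>T n \<omega> - K \<omega>\<bar> > \<epsilon> / 2}"
  let ?u = "\<lambda>n. {\<omega>\<in>space M. \<bar>S n \<omega> + T n \<omega> - (J \<omega> + K \<omega>)\<bar> > \<epsilon>}"
  have lim: "(\<lambda>n. measure M (?s n) + measure M (?t n)) \<longlonglongrightarrow> 0 + 0"
    using S T \<open>\<epsilon> > 0\<close> unfolding conv_in_prob_def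
    by (intro tendsto_add) (blast intro: half_gt_zero)+
  have le: "measure M (?u n) \<le> measure M (?s n) + measure M (?t n)" for n
  proof -
    have "measure M (?u n) \<le> measure M (?s n \<union> ?t n)"
    proof (rule finite_measure_mono)
      have "\<bar>x + y - (j + k)\<bar> \<le> \<bar>x - j\<bar> + \<bar>y - k\<bar>" for x y j k :: real by arith
      then show "?u n \<subseteq> ?s n \<union> ?t n"
        by (smt (verit) Un_iff field_sum_of_halves mem_Collect_eq subsetI)
    qed measurable
    also have "\<dots> \<le> measure M (?s n) + measure M (?t n)"
      by (rule measure_Un_le) measurable
    finally show ?thesis .
  qed
  show "(\<lambda>n. measure M (?u n)) \<longlonglongrightarrow> 0"
  proof (rule tendsto_sandwich[OF _ _ tendsto_const])
    show "(\<lambda>n. measure M (?s n) + measure M (?t n)) \<longlonglongrightarrow> 0" using lim by (simp only: add_0_left)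
    show "\<forall>\<^sub>F n in sequentially. 0 \<le> measure M (?u n)" by (intro always_eventually allI measure_nonneg)
    show "\<forall>\<^sub>F n in sequentially. measure M (?u n) \<le> measure M (?s n) + measure M (?t n)"
      by (intro always_eventually allI le)
  qed
qed

lemma conv_in_prob_lincomb:
  assumes "finite_measure M" "finite I" and "\<And>i. i \<in> I \<Longrightarrow> conv_in_prob M (S i) (J i)"
  shows "conv_in_prob M (\<lambda>n \<omega>. \<Sum>i\<in>I. c i * S i n \<omega>) (\<lambda>\<omega>. \<Sum>i\<in>I. c i * J i \<omega>)"
  using assms(2,3)
proof (induction I rule: finite_induct)
  case empty
  then show ?case by (simp add: conv_in_prob_def)
next
  case (insert a I)
  then have "conv_in_prob M (\<lambda>n \<omega>. c a * S a n \<omega> + (\<Sum>i\<in>I. c i * S i n \<omega>))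
      (\<lambda>\<omega>. c a * J a \<omega> + (\<Sum>i\<in>I. c i * J i \<omega>))"
    by (intro conv_in_prob_add[OF assms(1)] conv_in_prob_scale) auto
  then show ?case using insert.hyps by simp
qed

text \<open>
  For a fixed partition the trapezoidal sum is already linear in the integrand, so only the limits
  in probability have to be combined.
\<close>

lemma has_stratonovich_integral_lincomb:
  assumes "finite_measure M" "finite I"
    and "\<And>i. i \<in> I \<Longrightarrow> has_stratonovich_integral M (H i) Z t (J i)"
  shows "has_stratonovich_integral M (\<lambda>s \<omega>. \<Sum>i\<in>I. c i * H i s \<omega>) Z t (\<lambda>\<omega>. \<Sum>i\<in>I. c i * J i \<omega>)"
  unfolding has_stratonovich_integral_def
proof (intro allI impI)
  fix N s assume p: "vanishing_partitions t N s"
  have "(\<Sum>l<N n. ((\<Sum>i\<in>I. c i * H i (s n l) \<omega>) + (\<Sum>i\<in>I. c i * H i (s n (Suc l)) \<omega>)) / 2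
            * (Z (s n (Suc l)) \<omega> - Z (s n l) \<omega>))
      = (\<Sum>i\<in>I. c i * (\<Sum>l<N n. (H i (s n l) \<omega> + H i (s n (Suc l)) \<omega>) / 2
            * (Z (s n (Suc l)) \<omega> - Z (s n l) \<omega>)))" (is "?l = ?r") for n \<omega>
  proof -
    have "?l = (\<Sum>l<N n. \<Sum>i\<in>I. c i * ((H i (s n l) \<omega> + H i (s n (Suc l)) \<omega>) / 2
            * (Z (s n (Suc l)) \<omega> - Z (s n l) \<omega>)))"
      unfolding sum.distrib[symmetric] sum_divide_distrib sum_distrib_right
      by (intro sum.cong refl) (simp add: distrib_left add_divide_distrib distrib_right mult.assoc)
    also have "\<dots> = ?r" by (subst sum.swap) (simp add: sum_distrib_left)
    finally show ?thesis .
  qed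
  then show "conv_in_prob M
     (\<lambda>n \<omega>. \<Sum>l<N n. ((\<Sum>i\<in>I. c i * H i (s n l) \<omega>) + (\<Sum>i\<in>I. c i * H i (s n (Suc l)) \<omega>)) / 2
        * (Z (s n (Suc l)) \<omega> - Z (s n l) \<omega>)) (\<lambda>\<omega>. \<Sum>i\<in>I. c i * J i \<omega>)"
    using conv_in_prob_lincomb[OF assms(1,2), of
        "\<lambda>i n \<omega>. \<Sum>l<N n. (H i (s n l) \<omega> + H i (s n (Suc l)) \<omega>) / 2 * (Z (s n (Suc l)) \<omega> - Z (s n l) \<omega>)" J c]
      assms(3) p
    unfolding has_stratonovich_integral_def by simp
qed

text \<open>
  Stopping acts pointwise on processes and therefore commutes with linear combinations, and for
  finitely many equations the exceptional null sets at a given time can be merged into one.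
\<close>

lemma stratonovich_eq_lincomb:
  fixes c :: "'i::finite \<Rightarrow> real"
  assumes M: "finite_measure M" and eq: "\<And>i. stratonovich_eq M Y \<tau> (Z i) (A i) (B i)"
  shows "stratonovich_eq M Y \<tau> (\<lambda>t \<omega>. \<Sum>i\<in>UNIV. c i * Z i t \<omega>)
     (\<lambda>t \<omega>. \<Sum>i\<in>UNIV. c i * A i t \<omega>) (\<lambda>k t \<omega>. \<Sum>i\<in>UNIV. c i * B i k t \<omega>)"
proof -
  have "\<forall>i. \<exists>J. (\<forall>k. \<forall>t\<ge>0. has_stratonovich_integral M (stopped \<tau> (B i k))
          (stopped \<tau> (\<lambda>s \<omega>. Y s \<omega> $ k)) t (J k t)) \<and>
        (\<forall>t\<ge>0. AE \<omega> in M. stopped \<tau> (Z i) t \<omega> - Z i 0 \<omega> =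
             (LINT s:{0..min t (\<tau> \<omega>)}|lborel. A i s \<omega>) + (\<Sum>k\<in>UNIV. J k t \<omega>))"
    using eq unfolding stratonovich_eq_def by blast
  from choice[OF this] obtain J where
    J: "\<And>i k t. 0 \<le> t \<Longrightarrow> has_stratonovich_integral M (stopped \<tau> (B i k))
          (stopped \<tau> (\<lambda>s \<omega>. Y s \<omega> $ k)) t (J i k t)"
    and Z: "\<And>i t. 0 \<le> t \<Longrightarrow> AE \<omega> in M. stopped \<tau> (Z i) t \<omega> - Z i 0 \<omega> =
             (LINT s:{0..min t (\<tau> \<omega>)}|lborel. A i s \<omega>) + (\<Sum>k\<in>UNIV. J i k t \<omega>)"
    by blast
  have A: "AE \<omega> in M. \<forall>i. set_integrable lborel {0..min t (\<tau> \<omega>)} (\<lambda>s. A i s \<omega>)" if "0 \<le> t" for t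
    using eq that unfolding stratonovich_eq_def by (subst AE_all_countable) blast
  have sum_A: "set_integrable lborel D (\<lambda>s. \<Sum>i\<in>UNIV. c i * A i s \<omega>)"
      "(LINT s:D|lborel. (\<Sum>i\<in>UNIV. c i * A i s \<omega>)) = (\<Sum>i\<in>UNIV. c i * (LINT s:D|lborel. A i s \<omega>))"
    if D: "\<forall>i. set_integrable lborel D (\<lambda>s. A i s \<omega>)" for D \<omega>
  proof -
    have I: "integrable lborel (\<lambda>s. c i * (indicator D s * A i s \<omega>))" for i
      using D[rule_format, of i] unfolding set_integrable_def by (intro integrable_mult_right) simp
    have e: "indicator D s *\<^sub>R (\<Sum>i\<in>UNIV. c i * A i s \<omega>)
        = (\<Sum>i\<in>UNIV. c i * (indicator D s * A i s \<omega>))" for s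
      by (simp add: sum_distrib_left mult.left_commute)
    show "set_integrable lborel D (\<lambda>s. \<Sum>i\<in>UNIV. c i * A i s \<omega>)"
      unfolding set_integrable_def e by (intro Bochner_Integration.integrable_sum I)
    show "(LINT s:D|lborel. (\<Sum>i\<in>UNIV. c i * A i s \<omega>)) = (\<Sum>i\<in>UNIV. c i * (LINT s:D|lborel. A i s \<omega>))"
      unfolding set_lebesgue_integral_def e using I by (subst Bochner_Integration.integral_sum) simp_all
  qed
  show ?thesis
    unfolding stratonovich_eq_def
  proof (intro conjI allI impI exI[of _ "\<lambda>k t \<omega>. \<Sum>i\<in>UNIV. c i * J i k t \<omega>"])
    fix t :: real assume t: "0 \<le> t"
    show "AE \<omega> in M. set_integrable lborel {0..min t (\<tau> \<omega>)} (\<lambda>s. \<Sum>i\<in>UNIV. c i * A i s \<omega>)"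
      using A[OF t] by eventually_elim (rule sum_A)
    show "has_stratonovich_integral M (stopped \<tau> (\<lambda>t \<omega>. \<Sum>i\<in>UNIV. c i * B i k t \<omega>))
        (stopped \<tau> (\<lambda>s \<omega>. Y s \<omega> $ k)) t (\<lambda>\<omega>. \<Sum>i\<in>UNIV. c i * J i k t \<omega>)" for k
      using has_stratonovich_integral_lincomb[OF M finite J[OF t], where c = c]
      by (simp add: stopped_def[abs_def])
    have "AE \<omega> in M. \<forall>i. stopped \<tau> (Z i) t \<omega> - Z i 0 \<omega> =
             (LINT s:{0..min t (\<tau> \<omega>)}|lborel. A i s \<omega>) + (\<Sum>k\<in>UNIV. J i k t \<omega>)"
      using Z[OF t] by (subst AE_all_countable) blast
    with A[OF t] show "AE \<omega> in M. stopped \<tau> (\<lambda>t \<omega>. \<Sum>i\<in>UNIV. c i * Z i t \<omega>) t \<omega> - (\<Sum>i\<in>UNIV. c i * Z i 0 \<omega>) =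
        (LINT s:{0..min t (\<tau> \<omega>)}|lborel. (\<Sum>i\<in>UNIV. c i * A i s \<omega>)) +
        (\<Sum>k\<in>UNIV. \<Sum>i\<in>UNIV. c i * J i k t \<omega>)"
    proof eventually_elim
      case (elim \<omega>)
      have "stopped \<tau> (\<lambda>t \<omega>. \<Sum>i\<in>UNIV. c i * Z i t \<omega>) t \<omega> - (\<Sum>i\<in>UNIV. c i * Z i 0 \<omega>)
          = (\<Sum>i\<in>UNIV. c i * (stopped \<tau> (Z i) t \<omega> - Z i 0 \<omega>))"
        by (simp add: stopped_def sum_subtractf right_diff_distrib)
      also have "\<dots> = (\<Sum>i\<in>UNIV. c i * (LINT s:{0..min t (\<tau> \<omega>)}|lborel. A i s \<omega>))
          + (\<Sum>i\<in>UNIV. \<Sum>k\<in>UNIV. c i * J i k t \<omega>)"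
        using elim(2) by (simp add: distrib_left sum.distrib sum_distrib_left)
      also have "(\<Sum>i\<in>UNIV. \<Sum>k\<in>UNIV. c i * J i k t \<omega>) = (\<Sum>k\<in>UNIV. \<Sum>i\<in>UNIV. c i * J i k t \<omega>)"
        by (rule sum.swap)
      finally show ?case
        using sum_A(2)[OF elim(1)] by simp
    qed
  qed
qed

text \<open>
  The drift enters through integrals over subsets of \<open>[0, \<infinity>)\<close> and the unknown only through its
  increments, so the equation sees neither the drift at negative times nor an additive constant in the unknown.
\<close>

lemma stratonovich_eq_cong_shift:
  assumes eq: "stratonovich_eq M Y \<tau> Z A B"
    and Z: "\<And>t \<omega>. Z' t \<omega> = Z t \<omega> + r"
    and A: "\<And>t \<omega>. 0 \<le> t \<Longrightarrow> A' t \<omega> = A t \<omega>"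
    and B: "\<And>k t \<omega>. B' k t \<omega> = B k t \<omega>"
  shows "stratonovich_eq M Y \<tau> Z' A' B'"
proof -
  have "set_integrable lborel {0..min t (\<tau> \<omega>)} (\<lambda>s. A' s \<omega>)
      = set_integrable lborel {0..min t (\<tau> \<omega>)} (\<lambda>s. A s \<omega>)"
    and "(LINT s:{0..min t (\<tau> \<omega>)}|lborel. A' s \<omega>) = (LINT s:{0..min t (\<tau> \<omega>)}|lborel. A s \<omega>)" for t \<omega>
    by (rule set_integrable_cong set_lebesgue_integral_cong; simp add: A)+
  moreover have "B' = B" using B by blast
  moreover have "stopped \<tau> Z' t \<omega> - Z' 0 \<omega> = stopped \<tau> Z t \<omega> - Z 0 \<omega>" for t \<omega>
    by (simp add: stopped_def Z)
  ultimately show ?thesis using eq unfolding stratonovich_eq_def by simp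
qed

lemma sum_matrix_inverse:
  fixes G H :: "real^'m^'m"
  assumes "G ** H = mat 1"
  shows "(\<Sum>i\<in>UNIV. G $ j $ i * (\<Sum>l\<in>UNIV. H $ i $ l * x l)) = x j"
proof -
  have "(\<Sum>i\<in>UNIV. G $ j $ i * (\<Sum>l\<in>UNIV. H $ i $ l * x l)) = (G *v (H *v (\<chi> l. x l))) $ j"
    by (simp add: matrix_vector_mult_def)
  also have "\<dots> = x j"
    using assms by (simp add: matrix_vector_mul_assoc)
  finally show ?thesis .
qed

text \<open>
  Multiplication of the system by \<open>G\<close> is a linear combination of its equations with constant
  coefficients, and it is undone by multiplication by the inverse.
\<close>

lemma stratonovich_eq_linear_system:
  fixes G :: "real^'m^'m"
  assumes M: "finite_measure M" and G: "invertible G"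
  shows "(\<forall>i. stratonovich_eq M Y \<tau> (Z i) (\<lambda>t \<omega>. \<Sum>j\<in>UNIV. matrix_inv G $ i $ j * A j t \<omega>)
            (\<lambda>k t \<omega>. \<Sum>j\<in>UNIV. matrix_inv G $ i $ j * B j k t \<omega>)) \<longleftrightarrow>
         (\<forall>j. stratonovich_eq M Y \<tau> (\<lambda>t \<omega>. \<Sum>i\<in>UNIV. G $ j $ i * Z i t \<omega>) (A j) (B j))"
    (is "?L \<longleftrightarrow> ?R")
proof
  have GH: "G ** matrix_inv G = mat 1" "matrix_inv G ** G = mat 1"
    using someI_ex[OF G[unfolded invertible_def]] unfolding matrix_inv_def by blast+
  show ?R if ?L
  proof
    fix j
    have "stratonovich_eq M Y \<tau> (\<lambda>t \<omega>. \<Sum>i\<in>UNIV. G $ j $ i * Z i t \<omega>)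
        (\<lambda>t \<omega>. \<Sum>i\<in>UNIV. G $ j $ i * (\<Sum>l\<in>UNIV. matrix_inv G $ i $ l * A l t \<omega>))
        (\<lambda>k t \<omega>. \<Sum>i\<in>UNIV. G $ j $ i * (\<Sum>l\<in>UNIV. matrix_inv G $ i $ l * B l k t \<omega>))"
      by (rule stratonovich_eq_lincomb[OF M]) (rule that[rule_format])
    then show "stratonovich_eq M Y \<tau> (\<lambda>t \<omega>. \<Sum>i\<in>UNIV. G $ j $ i * Z i t \<omega>) (A j) (B j)"
      by (simp add: sum_matrix_inverse[OF GH(1)])
  qed
  show ?L if ?R
  proof
    fix i
    have "stratonovich_eq M Y \<tau>
        (\<lambda>t \<omega>. \<Sum>j\<in>UNIV. matrix_inv G $ i $ j * (\<Sum>l\<in>UNIV. G $ j $ l * Z l t \<omega>))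
        (\<lambda>t \<omega>. \<Sum>j\<in>UNIV. matrix_inv G $ i $ j * A j t \<omega>)
        (\<lambda>k t \<omega>. \<Sum>j\<in>UNIV. matrix_inv G $ i $ j * B j k t \<omega>)"
      by (rule stratonovich_eq_lincomb[OF M]) (rule that[rule_format])
    then show "stratonovich_eq M Y \<tau> (Z i) (\<lambda>t \<omega>. \<Sum>j\<in>UNIV. matrix_inv G $ i $ j * A j t \<omega>)
            (\<lambda>k t \<omega>. \<Sum>j\<in>UNIV. matrix_inv G $ i $ j * B j k t \<omega>)"
      by (simp add: sum_matrix_inverse[OF GH(2)])
  qed
qed

section \<open>Invertibility of the Gram matrix\<close>

lemma integrable_mult_square_integrable:
  fixes u v :: "'a \<Rightarrow> real"
  assumes [measurable]: "u \<in> borel_measurable M" "v \<in> borel_measurable M"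
    and "integrable M (\<lambda>x. (u x)\<^sup>2)" "integrable M (\<lambda>x. (v x)\<^sup>2)"
  shows "integrable M (\<lambda>x. u x * v x)"
proof (rule Bochner_Integration.integrable_bound)
  show "integrable M (\<lambda>x. (u x)\<^sup>2 + (v x)\<^sup>2)" using assms(3,4) by simp
  have "\<bar>u x * v x\<bar> \<le> (u x)\<^sup>2 + (v x)\<^sup>2" for x
  proof -
    have "0 \<le> \<bar>u x\<bar> * \<bar>v x\<bar>" by simp
    then show ?thesis
      using sum_squares_bound[of "\<bar>u x\<bar>" "\<bar>v x\<bar>"] unfolding abs_mult power2_abs by linarith
  qed
  then show "AE x in M. norm (u x * v x) \<le> norm ((u x)\<^sup>2 + (v x)\<^sup>2)" by simp
qed simp

lemma l2_inner_commute: "l2_inner u v = l2_inner v u"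
  by (simp add: l2_inner_def mult.commute)

text \<open>
  If \<open>h c = 0\<close> then \<open>0 = c\<^sup>T h c\<close>, which is the squared \<open>L\<^sup>2\<close> norm of \<open>\<Sum>\<^sub>i c\<^sub>i v\<^sub>i\<close>; this function
  therefore vanishes almost everywhere and independence gives \<open>c = 0\<close>.
\<close>

lemma invertible_gram:
  assumes int: "\<And>i j. integrable lborel (\<lambda>x. tangent p \<eta> i x * tangent p \<eta> j x)"
    and ind: "l2_independent (tangent p \<eta>)"
  shows "invertible (gram p \<eta>)"
proof -
  let ?v = "tangent p \<eta>"
  have "c = 0" if c: "gram p \<eta> *v c = 0" for c
  proof -
    have sq: "(\<Sum>i\<in>UNIV. c $ i * ?v i x)\<^sup>2 =
        (\<Sum>i\<in>UNIV. \<Sum>j\<in>UNIV. c $ i * (c $ j * (?v i x * ?v j x)))" for x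
      by (simp add: power2_eq_square sum_product mult_ac)
    have "(\<integral>x. (\<Sum>i\<in>UNIV. c $ i * ?v i x)\<^sup>2 \<partial>lborel) =
        (\<Sum>i\<in>UNIV. \<Sum>j\<in>UNIV. c $ i * (c $ j * l2_inner (?v i) (?v j)))"
      unfolding sq l2_inner_def
      by (simp add: Bochner_Integration.integral_sum Bochner_Integration.integrable_sum int)
    also have "\<dots> = (\<Sum>i\<in>UNIV. c $ i * (gram p \<eta> *v c) $ i)"
      by (simp add: gram_def matrix_vector_mult_def sum_distrib_left mult_ac)
    also have "\<dots> = 0" by (simp add: c)
    finally have "(\<integral>x. (\<Sum>i\<in>UNIV. c $ i * ?v i x)\<^sup>2 \<partial>lborel) = 0" .
    moreover have "integrable lborel (\<lambda>x. (\<Sum>i\<in>UNIV. c $ i * ?v i x)\<^sup>2)"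
      unfolding sq by (intro Bochner_Integration.integrable_sum integrable_mult_right int)
    ultimately have "AE x in lborel. (\<Sum>i\<in>UNIV. c $ i * ?v i x)\<^sup>2 = 0"
      by (subst (asm) integral_nonneg_eq_0_iff_AE) auto
    then have "AE x in lborel. (\<Sum>i\<in>UNIV. c $ i * ?v i x) = 0" by simp
    then have "\<forall>i. c $ i = 0" using ind unfolding l2_independent_def by blast
    then show "c = 0" by (simp add: vec_eq_iff)
  qed
  then show ?thesis by (simp add: invertible_left_inverse matrix_left_invertible_ker)
qed

section \<open>The simple mixture family\<close>

lemma pdiff_diff:
  assumes "(\<lambda>s. u (x + s *\<^sub>R axis i 1)) differentiable (at (0::real))"
    and "(\<lambda>s. v (x + s *\<^sub>R axis i 1)) differentiable (at (0::real))"
  shows "pdiff i (\<lambda>y. u y - v y) x = pdiff i u x - pdiff i v x"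
  using assms unfolding pdiff_def
  by (intro deriv_diff) (auto simp: real_differentiable_def field_differentiable_def)

lemma backward_op_diff:
  assumes "twice_pdifferentiable u" "twice_pdifferentiable v"
  shows "backward_op f \<sigma> (\<lambda>y. u y - v y) x = backward_op f \<sigma> u x - backward_op f \<sigma> v x"
proof -
  have 1: "pdiff i (\<lambda>y. u y - v y) = (\<lambda>x. pdiff i u x - pdiff i v x)" for i
    using assms unfolding twice_pdifferentiable_def by (intro ext pdiff_diff) auto
  have 2: "pdiff i (\<lambda>x. pdiff j u x - pdiff j v x) x = pdiff i (pdiff j u) x - pdiff i (pdiff j v) x"
    for i j
    using assms unfolding twice_pdifferentiable_def by (intro pdiff_diff) auto
  show ?thesis
    unfolding backward_op_def 1 2 by (simp add: right_diff_distrib sum_subtractf)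
qed

lemma sum_UNIV_option:
  fixes g :: "'m::finite option \<Rightarrow> 'a::comm_monoid_add"
  shows "(\<Sum>r\<in>UNIV. g r) = g None + (\<Sum>i\<in>UNIV. g (Some i))"
  by (simp add: UNIV_option_conv sum.reindex)

lemma galerkin_sum_mixture: "galerkin_sum (mixture_basis q) (mixture_coeff \<eta>) = mixture q \<eta>"
  by (rule ext) (simp add: galerkin_sum_def mixture_def mixture_coeff_def sum_UNIV_option
      sum_subtractf right_diff_distrib left_diff_distrib sum_distrib_right)

lemma tangent_mixture:
  fixes q :: "'a::finite option \<Rightarrow> real^'n \<Rightarrow> real"
  shows "tangent (mixture q) \<eta> i = mixture_basis q (Some i)"
proof
  fix x
  have "mixture q (\<eta> + s *\<^sub>R axis i 1) x = mixture q \<eta> x + s * mixture_basis q (Some i) x" for s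
  proof -
    have ax: "(\<Sum>k\<in>UNIV. axis i 1 $ k * g k) = g i" for g :: "'a \<Rightarrow> real"
      by (simp add: axis_def if_distrib[of "\<lambda>c. c * _"] cong: if_cong)
    show ?thesis
      using ax[of "\<lambda>_. 1"]
      by (simp add: mixture_def distrib_right sum.distrib mult.assoc ax flip: sum_distrib_left)
        (simp add: algebra_simps)
  qed
  then have "tangent (mixture q) \<eta> i x =
      deriv (\<lambda>s. mixture q \<eta> x + s * mixture_basis q (Some i) x) 0"
    by (simp add: tangent_def pdiff_def)
  also have "\<dots> = mixture_basis q (Some i) x"
    by (rule DERIV_imp_deriv) (auto intro!: derivative_eq_intros)
  finally show "tangent (mixture q) \<eta> i x = mixture_basis q (Some i) x" .
qed

lemma integrable_mixture_basis_mult: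
  assumes "\<And>r. l2_density (q r)"
  shows "integrable lborel (\<lambda>x. mixture_basis q (Some i) x * mixture_basis q (Some j) x)"
proof -
  have "integrable lborel (\<lambda>x. q r x * q s x)" for r s
    using assms[of r] assms[of s] unfolding l2_density_def
    by (intro integrable_mult_square_integrable) auto
  then show ?thesis by (simp add: algebra_simps)
qed

text \<open>
  The products of \<open>q\<^sub>r\<close> with \<open>\<L> q\<^sub>s\<close> are integrable, hence so are those of a basis function with
  \<open>\<L> v\<^sub>j = \<L> q\<^sub>j - \<L> q\<^sub>m\<^sub>+\<^sub>1\<close>; this is what allows the expansion of \<open>p(\<theta>)\<close> in the Galerkin basis
  to be taken out of the integral.
\<close>

lemma l2_inner_mixture_backward_op:
  assumes "\<And>r. twice_pdifferentiable (q r)"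
    and int: "\<And>r s. integrable lborel (\<lambda>x. q r x * backward_op f \<sigma> (q s) x)"
  shows "l2_inner (mixture q \<eta>) (backward_op f \<sigma> (mixture_basis q (Some j))) =
    (\<Sum>r\<in>UNIV. l2_inner (mixture_basis q r) (backward_op f \<sigma> (mixture_basis q (Some j)))
       * mixture_coeff \<eta> $ r)"
proof -
  let ?L = "backward_op f \<sigma> (mixture_basis q (Some j))"
  have "mixture_basis q (Some j) = (\<lambda>y. q (Some j) y - q None y)" by (rule ext) simp
  then have L: "?L x = backward_op f \<sigma> (q (Some j)) x - backward_op f \<sigma> (q None) x" for x
    by (simp add: backward_op_diff assms(1))
  have "integrable lborel (\<lambda>x. mixture_basis q r x * ?L x)" for r
    by (cases r) (simp_all add: L algebra_simps int)
  then show ?thesis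
    by (simp add: l2_inner_def galerkin_sum_def sum_distrib_right mult.assoc
        mult.commute[of "integral\<^sup>L _ _"] Bochner_Integration.integral_sum flip: galerkin_sum_mixture)
qed

theorem theorem5p1:
  fixes M :: "'w measure" and F :: "real \<Rightarrow> 'w measure"
    and f :: "real \<Rightarrow> real^'n \<Rightarrow> real^'n"
    and \<sigma> :: "real \<Rightarrow> real^'n \<Rightarrow> real^'r^'n"
    and b :: "real \<Rightarrow> real^'n \<Rightarrow> real^'d"
    and X :: "real \<Rightarrow> 'w \<Rightarrow> real^'n" and Y :: "real \<Rightarrow> 'w \<Rightarrow> real^'d"
    and W :: "real \<Rightarrow> 'w \<Rightarrow> real^'r" and V :: "real \<Rightarrow> 'w \<Rightarrow> real^'d"
    and q :: "'m::finite option \<Rightarrow> real^'n \<Rightarrow> real"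
    and \<tau> :: "'w \<Rightarrow> real" and \<theta> :: "real \<Rightarrow> 'w \<Rightarrow> real^'m"
  assumes "filtering_problem M F f \<sigma> b X Y W V"
    and "\<And>j. l2_density (q j)"
    and "\<And>\<eta>. \<eta> \<in> mixture_domain \<Longrightarrow> l2_independent (tangent (mixture q) \<eta>)"
    \<comment> \<open>the terms of the two equations are meaningful\<close>
    and "\<And>j. twice_pdifferentiable (q j)"
    and "\<And>t i j. 0 \<le> t \<Longrightarrow> integrable lborel (\<lambda>x. q i x * backward_op (f t) (\<sigma> t) (q j) x)"
    and "\<And>t i. 0 \<le> t \<Longrightarrow> integrable lborel (\<lambda>x. (norm (b t x))\<^sup>2 * q i x)"
    and "\<And>t i j. 0 \<le> t \<Longrightarrow> integrable lborel (\<lambda>x. (norm (b t x))\<^sup>2 * q i x * q j x)"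
    \<comment> \<open>a continuous adapted process in the family up to a stopping time\<close>
    and "stopping_time F \<tau>" and "\<And>\<omega>. \<omega> \<in> space M \<Longrightarrow> 0 \<le> \<tau> \<omega>"
    and "adapted F \<theta>"
    and "\<And>\<omega>. \<omega> \<in> space M \<Longrightarrow> continuous_on {0..\<tau> \<omega>} (\<lambda>t. \<theta> t \<omega>)"
    and "\<And>\<omega> t. \<omega> \<in> space M \<Longrightarrow> 0 \<le> t \<Longrightarrow> t \<le> \<tau> \<omega> \<Longrightarrow> \<theta> t \<omega> \<in> mixture_domain"
  shows "(\<forall>\<eta>. galerkin_sum (mixture_basis q) (mixture_coeff \<eta>) = mixture q \<eta>) \<and>
        (projection_filter M f \<sigma> b Y \<tau> (mixture q) \<theta> \<longleftrightarrow>
         galerkin_method M f \<sigma> b Y \<tau> (mixture_basis q) (range Some) (\<lambda>t \<omega>. mixture_coeff (\<theta> t \<omega>)))"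
proof
  show "\<forall>\<eta>. galerkin_sum (mixture_basis q) (mixture_coeff \<eta>) = mixture q \<eta>"
    by (simp add: galerkin_sum_mixture)
  have M: "finite_measure M"
    using assms(1) unfolding filtering_problem_def by (auto intro: prob_space.finite_measure)
  let ?\<phi> = "mixture_basis q"
  define G :: "real^'m^'m" where "G = (\<chi> i j. l2_inner (?\<phi> (Some i)) (?\<phi> (Some j)))"
  have gram: "gram (mixture q) \<eta> = G" for \<eta>
    by (simp add: gram_def G_def tangent_mixture)
  \<comment> \<open>\<open>h\<close> is constant, so independence at one parameter, such as 0, is enough.\<close>
  have "(0 :: real^'m) \<in> mixture_domain" by (simp add: mixture_domain_def)
  then have "invertible (gram (mixture q) 0)"
    using integrable_mixture_basis_mult[OF assms(2)] assms(3)
    by (intro invertible_gram) (simp_all add: tangent_mixture)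
  then have G: "invertible G" by (simp add: gram)

  define A where "A = (\<lambda>j t \<omega>. l2_inner (mixture q (\<theta> t \<omega>)) (backward_op (f t) (\<sigma> t) (?\<phi> (Some j))) -
      l2_inner (gamma0 (b t) (mixture q (\<theta> t \<omega>))) (?\<phi> (Some j)))"
  define B where "B = (\<lambda>j k t \<omega>. l2_inner (gamma (b t) k (mixture q (\<theta> t \<omega>))) (?\<phi> (Some j)))"
  define A' where "A' = (\<lambda>j t \<omega>. (\<Sum>i\<in>UNIV. l2_inner (?\<phi> i) (backward_op (f t) (\<sigma> t) (?\<phi> (Some j)))
        * mixture_coeff (\<theta> t \<omega>) $ i) -
      l2_inner (gamma0 (b t) (mixture q (\<theta> t \<omega>))) (?\<phi> (Some j)))"
  have A: "A' j t \<omega> = A j t \<omega>" if "0 \<le> t" for j t \<omega>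
    using l2_inner_mixture_backward_op[where q = q, OF assms(4) assms(5)[OF that]]
    by (simp add: A_def A'_def)
  \<comment> \<open>The prescribed coefficient 1 contributes the constant \<open>\<langle>q\<^sub>m\<^sub>+\<^sub>1, v\<^sub>j\<rangle>\<close>.\<close>
  have Z: "(\<Sum>i\<in>UNIV. l2_inner (?\<phi> i) (?\<phi> (Some j)) * mixture_coeff (\<theta> t \<omega>) $ i) =
      (\<Sum>i\<in>UNIV. G $ j $ i * \<theta> t \<omega> $ i) + l2_inner (?\<phi> None) (?\<phi> (Some j))" for j t \<omega>
    by (simp add: sum_UNIV_option mixture_coeff_def G_def l2_inner_commute[of "?\<phi> (Some j)"])

  have "projection_filter M f \<sigma> b Y \<tau> (mixture q) \<theta> \<longleftrightarrow>
      (\<forall>i. stratonovich_eq M Y \<tau> (\<lambda>t \<omega>. \<theta> t \<omega> $ i)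
        (\<lambda>t \<omega>. \<Sum>j\<in>UNIV. matrix_inv G $ i $ j * A j t \<omega>)
        (\<lambda>k t \<omega>. \<Sum>j\<in>UNIV. matrix_inv G $ i $ j * B j k t \<omega>))"
    by (simp add: projection_filter_def gram tangent_mixture A_def B_def)
  also have "\<dots> \<longleftrightarrow> (\<forall>j. stratonovich_eq M Y \<tau> (\<lambda>t \<omega>. \<Sum>i\<in>UNIV. G $ j $ i * \<theta> t \<omega> $ i) (A j) (B j))"
    by (rule stratonovich_eq_linear_system[OF M G])
  also have "\<dots> \<longleftrightarrow> (\<forall>j. stratonovich_eq M Y \<tau>
      (\<lambda>t \<omega>. \<Sum>i\<in>UNIV. l2_inner (?\<phi> i) (?\<phi> (Some j)) * mixture_coeff (\<theta> t \<omega>) $ i) (A' j) (B j))"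
  proof (intro iff_allI iffI)
    fix j
    show "stratonovich_eq M Y \<tau>
        (\<lambda>t \<omega>. \<Sum>i\<in>UNIV. l2_inner (?\<phi> i) (?\<phi> (Some j)) * mixture_coeff (\<theta> t \<omega>) $ i) (A' j) (B j)"
      if "stratonovich_eq M Y \<tau> (\<lambda>t \<omega>. \<Sum>i\<in>UNIV. G $ j $ i * \<theta> t \<omega> $ i) (A j) (B j)"
      using that by (rule stratonovich_eq_cong_shift[where r = "l2_inner (?\<phi> None) (?\<phi> (Some j))"])
        (simp_all only: Z A)
    show "stratonovich_eq M Y \<tau> (\<lambda>t \<omega>. \<Sum>i\<in>UNIV. G $ j $ i * \<theta> t \<omega> $ i) (A j) (B j)"
      if "stratonovich_eq M Y \<tau>
        (\<lambda>t \<omega>. \<Sum>i\<in>UNIV. l2_inner (?\<phi> i) (?\<phi> (Some j)) * mixture_coeff (\<theta> t \<omega>) $ i) (A' j) (B j)"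
      using that by (rule stratonovich_eq_cong_shift[where r = "- l2_inner (?\<phi> None) (?\<phi> (Some j))"])
        (simp_all add: Z A)
  qed
  also have "\<dots> \<longleftrightarrow> galerkin_method M f \<sigma> b Y \<tau> ?\<phi> (range Some) (\<lambda>t \<omega>. mixture_coeff (\<theta> t \<omega>))"
    by (simp add: galerkin_method_def galerkin_sum_mixture A'_def B_def)
  finally show "projection_filter M f \<sigma> b Y \<tau> (mixture q) \<theta> \<longleftrightarrow>
      galerkin_method M f \<sigma> b Y \<tau> ?\<phi> (range Some) (\<lambda>t \<omega>. mixture_coeff (\<theta> t \<omega>))" .
qed

end
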